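(* Suppose $K$ is a compact Hausdorff space and $F$ is a Banach lattice with quasi-interior point $u$ and ideal center $Z(F)=C(K)$. Suppose $X$ is a Banach space. Let $T$ be an operator (bounded linear operator) on $F_\pi(X)$. Then $T$ is a multiplication operator (i.e. there is $a\in C(K)$ with $T(f)=af$ for all $f\in F_\pi(X)$) if and only if both of the following conditions hold: (iia) for each $x\in X$, the cyclic subspace $F(\overset{\rightarrow}{x})$ is left invariant by $T$, i.e. $T(F(\overset{\rightarrow}{x}))\subset F(\overset{\rightarrow}{x})$; (iib) for each $x\in X$, $T$ commutes with $C(K)$ on $F(\overset{\rightarrow}{x})$, i.e. $T(ag)=aT(g)$ for all $a\in C(K)$ and $g\in F(\overset{\rightarrow}{x})$.
   Context: Scalars are real. The ideal center $Z(F)$ of a Banach lattice $F$ is the algebra of operators $T$ on $F$ such that for some $\lambda>0$, $|T(x)|\le\lambda x$ for all $0\le x\in F$; it is identified with $C(K)$ both as an algebra and as a Banach lattice. The quasi-interior point $u\geq 0$ means that $Z(F)u$ is dense in $F$; it is normalized by $\|u\|_F=1$. Each $a\in C(K)$ is identified with the element $au\in F$ (so $u$ is identified with the constant function $1$, and $C(K)$ with the order ideal of $F$ generated by $u$). $C(K,X)$ is the space of continuous functions $K\to X$; for $f\in C(K,X)$ the norm function $|f|_X\in C(K)$ is $|f|_X(t)=\|f(t)\|$. $F_\pi(X)$ is the completion of $C(K,X)$ in the norm $\|f\|_{F(X)}=\|\,|f|_X\|_F$ (that is, $\|\,|f|_X u\|_F$); it is a Banach $C(K)$-module, extending pointwise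 multiplication. For $x\in X$, $\overset{\rightarrow}{x}\in C(K,X)$ is the constant function with value $x$, and the cyclic subspace $F(\overset{\rightarrow}{x})$ is the closure of $\{a\overset{\rightarrow}{x}: a\in C(K)\}$ in $F_\pi(X)$. *)

theory Defs
  imports "HOL-Analysis.Analysis" "HOL-Library.Lattice_Algebras"
begin

class banach_lattice = banach + ordered_real_vector + lattice_ab_group_add_abs +
  assumes abs_le_imp_norm_le: "\<bar>x\<bar> \<le> \<bar>y\<bar> \<Longrightarrow> norm x \<le> norm y"

text \<open>
  For compact \<open>K\<close>, the space \<open>C(K, X)\<close> is the type \<open>'k \<Rightarrow>\<^sub>C 'x\<close> of bounded continuous functions:
  boundedness is automatic.
\<close>

context
  includes bcontfun.lifting
begin

lift_definition norm_fun ::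
    "('k::topological_space \<Rightarrow>\<^sub>C 'x::real_normed_vector) \<Rightarrow> 'k \<Rightarrow>\<^sub>C real"
  is "\<lambda>f t. norm (f t)"
  by (auto simp: bcontfun_def bounded_norm_comp intro!: continuous_intros)

lift_definition pscale ::
    "('k::topological_space \<Rightarrow>\<^sub>C real) \<Rightarrow> ('k \<Rightarrow>\<^sub>C 'x::real_normed_vector) \<Rightarrow> 'k \<Rightarrow>\<^sub>C 'x"
  is "\<lambda>a f t. a t *\<^sub>R f t"
proof -
  fix a :: "'k \<Rightarrow> real" and f :: "'k \<Rightarrow> 'x"
  assume "a \<in> bcontfun" "f \<in> bcontfun"
  then obtain A B where "\<And>t. \<bar>a t\<bar> \<le> A" "\<And>t. norm (f t) \<le> B"
    and "continuous_on UNIV a" "continuous_on UNIV f"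
    by (auto simp: bcontfun_def bounded_iff)
  then show "(\<lambda>t. a t *\<^sub>R f t) \<in> bcontfun"
    by (intro bcontfun_normI[where b = "A * B"] continuous_on_scaleR)
      (auto intro!: mult_mono intro: order_trans[OF abs_ge_zero])
qed

end

definition ideal_center :: "('f::banach_lattice \<Rightarrow>\<^sub>L 'f) set" where
  "ideal_center = {S. \<exists>c>0. \<forall>x\<ge>0. \<bar>blinfun_apply S x\<bar> \<le> c *\<^sub>R x}"

definition quasi_interior :: "'f::banach_lattice \<Rightarrow> bool" where
  "quasi_interior u \<longleftrightarrow> 0 \<le> u \<and> closure ((\<lambda>S. blinfun_apply S u) ` ideal_center) = UNIV"

text \<open>
  The identification \<open>Z(F) = C(K)\<close> is a map \<open>J\<close> from \<open>C(K)\<close> onto \<open>Z(F)\<close> that is an isomorphism of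
  unital algebras and of Banach lattices; operators are ordered by their values on the positive cone.
\<close>

definition center_identification ::
    "(('k::topological_space \<Rightarrow>\<^sub>C real) \<Rightarrow> ('f::banach_lattice \<Rightarrow>\<^sub>L 'f)) \<Rightarrow> bool" where
  "center_identification J \<longleftrightarrow>
     linear J \<and> bij_betw J UNIV ideal_center \<and>
     J (const_bcontfun 1) = id_blinfun \<and>
     (\<forall>a b. J (pscale a b) = J a o\<^sub>L J b) \<and>
     (\<forall>a. norm (J a) = norm a) \<and>
     (\<forall>a b. (\<forall>t. apply_bcontfun a t \<le> apply_bcontfun b t) \<longleftrightarrow>
            (\<forall>x\<ge>0. blinfun_apply (J a) x \<le> blinfun_apply (J b) x))"

definition F_norm ::
    "(('k::topological_space \<Rightarrow>\<^sub>C real) \<Rightarrow> ('f::banach_lattice \<Rightarrow>\<^sub>L 'f)) \<Rightarrow> 'f \<Rightarrow>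
     ('k \<Rightarrow>\<^sub>C 'x::real_normed_vector) \<Rightarrow> real" where
  "F_norm J u f = norm (blinfun_apply (J (norm_fun f)) u)"

text \<open>
  A type cannot depend on \<open>J\<close> and \<open>u\<close>, so the completion \<open>F\<^sub>\<pi>(X)\<close> is an arbitrary Banach space \<open>'e\<close>
  with an isometric linear map \<open>\<iota>\<close> of \<open>C(K, X)\<close> onto a dense subspace; this determines it up to
  isometric isomorphism.
\<close>

definition is_completion :: "('v::real_vector \<Rightarrow> real) \<Rightarrow> ('v \<Rightarrow> 'e::banach) \<Rightarrow> bool" where
  "is_completion p \<iota> \<longleftrightarrow>
     linear \<iota> \<and> (\<forall>f. norm (\<iota> f) = p f) \<and> closure (range \<iota>) = UNIV"

text \<open>
  The module action of \<open>a\<close> is the continuous extension of pointwise multiplication; it exists and is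
  unique by \<open>module_action_ex1\<close> below.
\<close>

definition module_action ::
    "(('k::topological_space \<Rightarrow>\<^sub>C 'x::real_normed_vector) \<Rightarrow> 'e::banach) \<Rightarrow>
     ('k \<Rightarrow>\<^sub>C real) \<Rightarrow> 'e \<Rightarrow>\<^sub>L 'e" where
  "module_action \<iota> a = (THE S. \<forall>f. blinfun_apply S (\<iota> f) = \<iota> (pscale a f))"

definition cyclic_subspace ::
    "(('k::topological_space \<Rightarrow>\<^sub>C 'x::real_normed_vector) \<Rightarrow> 'e::banach) \<Rightarrow> 'x \<Rightarrow> 'e set" where
  "cyclic_subspace \<iota> x = closure (range (\<lambda>a. \<iota> (pscale a (const_bcontfun x))))"

lemma F_norm_pscale_le:
  fixes f :: "'k::topological_space \<Rightarrow>\<^sub>C 'x::real_normed_vector"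
  assumes J: "center_identification J" and u: "0 \<le> u"
  shows "F_norm J u (pscale a f) \<le> norm a * F_norm J u f"
proof -
  have lin: "linear J"
    and ord: "\<And>a b. (\<forall>t. apply_bcontfun a t \<le> apply_bcontfun b t) \<longleftrightarrow>
                (\<forall>x\<ge>0. blinfun_apply (J a) x \<le> blinfun_apply (J b) x)"
    using J unfolding center_identification_def by blast+
  let ?p = "blinfun_apply (J (norm_fun (pscale a f))) u"
  let ?q = "blinfun_apply (J (norm a *\<^sub>R norm_fun f)) u"
  have "\<forall>x\<ge>0. blinfun_apply (J 0) x \<le> blinfun_apply (J (norm_fun (pscale a f))) x"
    unfolding ord[symmetric] by (simp add: norm_fun.rep_eq)
  then have p0: "0 \<le> ?p"
    using u by (simp add: linear_0[OF lin])
  have "\<forall>x\<ge>0. blinfun_apply (J (norm_fun (pscale a f))) x \<le>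
               blinfun_apply (J (norm a *\<^sub>R norm_fun f)) x"
    unfolding ord[symmetric]
    using norm_bounded[of a]
    by (auto simp: norm_fun.rep_eq pscale.rep_eq intro!: mult_right_mono)
  then have pq: "?p \<le> ?q" using u by blast
  have "norm ?p \<le> norm ?q"
    using p0 pq by (intro abs_le_imp_norm_le) auto
  also have "?q = norm a *\<^sub>R blinfun_apply (J (norm_fun f)) u"
    by (simp add: linear_scale[OF lin] blinfun.scaleR_left)
  finally show ?thesis by (simp add: F_norm_def)
qed

lemma module_action_ex1:
  fixes J :: "('k::topological_space \<Rightarrow>\<^sub>C real) \<Rightarrow> ('f::banach_lattice \<Rightarrow>\<^sub>L 'f)"
    and \<iota> :: "('k \<Rightarrow>\<^sub>C 'x::real_normed_vector) \<Rightarrow> 'e::banach"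
  assumes J: "center_identification J" and u: "0 \<le> u"
    and \<iota>: "is_completion (F_norm J u) \<iota>"
  shows "\<exists>!S. \<forall>f. blinfun_apply S (\<iota> f) = \<iota> (pscale a f)"
proof -
  have lin: "linear \<iota>" and iso: "\<And>f. norm (\<iota> f) = F_norm J u f"
    and dense: "closure (range \<iota>) = UNIV"
    using \<iota> unfolding is_completion_def by auto
  have pd: "pscale a (f - g) = pscale a f - pscale a g"
    and pa: "pscale a (f + g) = pscale a f + pscale a g"
    and ps: "pscale a (r *\<^sub>R f) = r *\<^sub>R pscale a f" for f g :: "'k \<Rightarrow>\<^sub>C 'x" and r
    by (auto intro!: bcontfun_eqI simp: pscale.rep_eq algebra_simps)
  have le: "norm (\<iota> (pscale a f) - \<iota> (pscale a g)) \<le> norm a * norm (\<iota> f - \<iota> g)" for f g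
    using F_norm_pscale_le[OF J u, of a "f - g"]
    by (simp add: iso[symmetric] pd linear_diff[OF lin])
  define h where "h y = \<iota> (pscale a (inv \<iota> y))" for y
  have h: "h (\<iota> f) = \<iota> (pscale a f)" for f
    using le[of "inv \<iota> (\<iota> f)" f] by (simp add: h_def f_inv_into_f)
  have "(norm a)-lipschitz_on (range \<iota>) h"
    by (rule lipschitz_onI) (auto simp: h dist_norm le)
  then have "uniformly_continuous_on (range \<iota>) h"
    by (rule lipschitz_on_uniformly_continuous)
  then obtain g where ug: "uniformly_continuous_on (closure (range \<iota>)) g"
    and eq: "\<And>y. y \<in> range \<iota> \<Longrightarrow> h y = g y"
    by (rule uniformly_continuous_on_extension_on_closure) blast
  have cg: "isCont g y" for y
    using uniformly_continuous_imp_continuous[OF ug]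
    by (simp add: dense continuous_on_eq_continuous_at)
  have g: "g (\<iota> f) = \<iota> (pscale a f)" for f
    using eq[of "\<iota> f"] h by simp
  have approx: "\<exists>F. (\<lambda>n. \<iota> (F n)) \<longlonglongrightarrow> y" for y
  proof -
    have "y \<in> closure (range \<iota>)" by (simp add: dense)
    then obtain s where s: "\<And>n::nat. s n \<in> range \<iota>" "s \<longlonglongrightarrow> y"
      unfolding closure_sequential by blast
    then have "\<iota> (inv \<iota> (s n)) = s n" for n by (simp add: f_inv_into_f)
    then show ?thesis using s(2) by (intro exI[of _ "\<lambda>n. inv \<iota> (s n)"]) simp
  qed
  have "bounded_linear g"
  proof (rule bounded_linear_intro[where K = "norm a"])
    fix y z :: 'e and r :: real
    obtain F G where F: "(\<lambda>n. \<iota> (F n)) \<longlonglongrightarrow> y" and G: "(\<lambda>n. \<iota> (G n)) \<longlonglongrightarrow> z"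
      using approx by metis
    note gF = isCont_tendsto_compose[OF cg F] and gG = isCont_tendsto_compose[OF cg G]
    have "(\<lambda>n. g (\<iota> (F n) + \<iota> (G n))) \<longlonglongrightarrow> g (y + z)"
      by (intro isCont_tendsto_compose[OF cg] tendsto_add F G)
    moreover have "g (\<iota> (F n) + \<iota> (G n)) = g (\<iota> (F n)) + g (\<iota> (G n))" for n
      by (simp add: linear_add[OF lin, symmetric] g pa)
    ultimately show "g (y + z) = g y + g z"
      by (intro LIMSEQ_unique[OF _ tendsto_add[OF gF gG]]) simp
    have "(\<lambda>n. g (r *\<^sub>R \<iota> (F n))) \<longlonglongrightarrow> g (r *\<^sub>R y)"
      by (intro isCont_tendsto_compose[OF cg] tendsto_intros F)
    moreover have "g (r *\<^sub>R \<iota> (F n)) = r *\<^sub>R g (\<iota> (F n))" for n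
      by (simp add: linear_scale[OF lin, symmetric] g ps)
    ultimately show "g (r *\<^sub>R y) = r *\<^sub>R g y"
      by (intro LIMSEQ_unique[OF _ tendsto_scaleR[OF tendsto_const[of r] gF]]) simp
    have "norm (g (\<iota> (F n))) \<le> norm (\<iota> (F n)) * norm a" for n
      using F_norm_pscale_le[OF J u, of a "F n"] by (simp add: g iso mult.commute)
    then show "norm (g y) \<le> norm y * norm a"
      by (intro LIMSEQ_le[OF tendsto_norm[OF gF] tendsto_mult[OF tendsto_norm[OF F] tendsto_const]])
        auto
  qed
  then have ex: "\<forall>f. blinfun_apply (Blinfun g) (\<iota> f) = \<iota> (pscale a f)"
    by (simp add: bounded_linear_Blinfun_apply g)
  show ?thesis
  proof (rule ex1I[of _ "Blinfun g"], rule ex)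
    fix S :: "'e \<Rightarrow>\<^sub>L 'e"
    assume S: "\<forall>f. blinfun_apply S (\<iota> f) = \<iota> (pscale a f)"
    show "S = Blinfun g"
    proof (rule blinfun_eqI)
      fix y
      obtain F where F: "(\<lambda>n. \<iota> (F n)) \<longlonglongrightarrow> y" using approx by blast
      have "(\<lambda>n. blinfun_apply S (\<iota> (F n))) \<longlonglongrightarrow> blinfun_apply S y"
        and "(\<lambda>n. blinfun_apply (Blinfun g) (\<iota> (F n))) \<longlonglongrightarrow> blinfun_apply (Blinfun g) y"
        by (rule blinfun.tendsto[OF tendsto_const F])+
      then show "blinfun_apply S y = blinfun_apply (Blinfun g) y"
        by (simp only: S ex LIMSEQ_unique)
    qed
  qed
qed

end

theory Submission
  imports Defs
begin

text \<open>
  Multiplication operators have both properties because multiplication by a function maps a simple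
  tensor \<open>b x\<close>, with \<open>b \<in> C(K)\<close> and \<open>x \<in> X\<close>, to a simple tensor with the same \<open>x\<close>, and because
  \<open>C(K)\<close> is commutative.

  For the converse, restrict \<open>T\<close> to the cyclic subspace of a vector \<open>x \<noteq> 0\<close>. The norm of \<open>\<iota>(b x)\<close> is
  \<open>\<parallel>x\<parallel> \<parallel>b u\<parallel>\<close>, so that subspace is a copy of \<open>F\<close>, with \<open>x\<close> in the place of \<open>u\<close>, and the image of
  \<open>x\<close> under \<open>T\<close> corresponds to a vector \<open>v\<close> of \<open>F\<close>. As \<open>T\<close> commutes with \<open>C(K)\<close> and is bounded,
  \<open>\<parallel>b v\<parallel> \<le> \<parallel>T\<parallel> \<parallel>b u\<parallel>\<close> for every \<open>b\<close>. This forces \<open>v\<close> to be \<open>a u\<close> for some \<open>a \<in> C(K)\<close>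
  (\<open>dominated_imp_J_u\<close>): approximate \<open>v\<close> by vectors \<open>b\<^sub>n u\<close> and truncate every \<open>b\<^sub>n\<close> at one level
  above \<open>\<parallel>T\<parallel>\<close>. The part cut off tends to zero, since on it \<open>b\<^sub>n\<close> would enlarge \<open>u\<close> by more than
  the inequality permits. The truncated functions are uniformly bounded, so the operators that they
  define converge strongly, and the limit is again dominated by a multiple of the identity: it lies
  in the ideal center, which is \<open>C(K)\<close> (\<open>J_u_limit\<close>).

  Hence \<open>T\<close> maps the constant function \<open>x\<close> to \<open>\<alpha>(x) x\<close> with \<open>\<alpha>(x) \<in> C(K)\<close>. At each point
  \<open>t\<close> of \<open>K\<close> the map \<open>x \<mapsto> \<alpha>(x)(t) x\<close> is linear and every vector is an eigenvector, so it is
  a scalar (\<open>linear_eigenvectors_imp_scalar\<close>). Therefore one function \<open>a\<close> serves for all \<open>x\<close>. The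
  operators \<open>T\<close> and multiplication by \<open>a\<close> agree on simple tensors, whose span is dense
  (\<open>simple_tensors_dense\<close>).
\<close>

section \<open>Norm and order in a Banach lattice\<close>

lemma norm_mono_banach_lattice:
  fixes x y :: "'f::banach_lattice"
  assumes "\<bar>x\<bar> \<le> y"
  shows "norm x \<le> norm y"
  by (rule abs_le_imp_norm_le) (rule order_trans[OF assms abs_ge_self])

lemma tendsto_abs_banach_lattice:
  fixes f :: "'a \<Rightarrow> 'f::banach_lattice"
  assumes "(f \<longlongrightarrow> l) A"
  shows "((\<lambda>n. \<bar>f n\<bar>) \<longlongrightarrow> \<bar>l\<bar>) A"
proof -
  have "norm (\<bar>f n\<bar> - \<bar>l\<bar>) \<le> norm (f n - l)" for n
    by (rule abs_le_imp_norm_le) (rule abs_triangle_ineq3)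
  moreover have "((\<lambda>n. norm (f n - l)) \<longlongrightarrow> 0) A"
    by (rule tendsto_norm_zero[OF LIM_zero[OF assms]])
  ultimately have "((\<lambda>n. \<bar>f n\<bar> - \<bar>l\<bar>) \<longlongrightarrow> 0) A"
    by (rule Lim_null_comparison[OF always_eventually[OF allI]])
  then show ?thesis by (rule LIM_zero_cancel)
qed

text \<open>
  The positive cone is the fixed point set of the absolute value, which is continuous; hence the
  order passes to norm limits.
\<close>

lemma tendsto_le_banach_lattice:
  fixes f g :: "nat \<Rightarrow> 'f::banach_lattice"
  assumes f: "f \<longlonglongrightarrow> a" and g: "g \<longlonglongrightarrow> b" and le: "\<And>n. f n \<le> g n"
  shows "a \<le> b"
proof -
  have "(\<lambda>n. \<bar>g n - f n\<bar>) \<longlonglongrightarrow> \<bar>b - a\<bar>"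
    by (intro tendsto_abs_banach_lattice tendsto_diff f g)
  moreover have "\<bar>g n - f n\<bar> = g n - f n" for n
    using le[of n] by (intro abs_of_nonneg) simp
  ultimately have "(\<lambda>n. g n - f n) \<longlonglongrightarrow> \<bar>b - a\<bar>" by simp
  then have "b - a = \<bar>b - a\<bar>"
    using tendsto_diff[OF g f] LIMSEQ_unique by blast
  then have "0 \<le> b - a" by (metis abs_ge_zero)
  then show ?thesis by simp
qed

section \<open>Continuous functions on a compact space\<close>

lemma apply_Bcontfun_compact:
  fixes g :: "'k::topological_space \<Rightarrow> 'x::real_normed_vector"
  assumes "compact (UNIV :: 'k set)" "continuous_on UNIV g"
  shows "apply_bcontfun (Bcontfun g) = g"
proof -
  have "bounded (range g)"
    using assms compact_continuous_image compact_imp_bounded by blast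
  with assms(2) show ?thesis by (intro Bcontfun_inverse) (simp add: bcontfun_def)
qed

declare pscale.rep_eq [simp] norm_fun.rep_eq [simp]

lemma linear_pscale_right: "linear (pscale a)"
  by (intro linearI bcontfun_eqI) (auto simp: algebra_simps)

lemma linear_pscale_left: "linear (\<lambda>a. pscale a f)"
  by (intro linearI bcontfun_eqI) (auto simp: algebra_simps)

lemma pscale_pscale: "pscale a (pscale b f) = pscale (pscale a b) f"
  by (rule bcontfun_eqI) simp

lemma pscale_commute: "pscale a (pscale b f) = pscale b (pscale a f)"
  by (rule bcontfun_eqI) simp

lemma pscale_one: "pscale (const_bcontfun 1) f = f"
  by (rule bcontfun_eqI) simp

lemma linear_const_bcontfun: "linear const_bcontfun"
  by (intro linearI bcontfun_eqI) auto

text \<open>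
  The range of \<open>f\<close> is covered by finitely many balls of radius \<open>e\<close>. The tents \<open>p x\<close> over these balls,
  pulled back along \<open>f\<close> and divided by their sum, form a partition of unity on the domain, and \<open>f\<close> is
  within \<open>e\<close> of the corresponding combination of the centers.
\<close>

lemma simple_tensors_dense:
  fixes f :: "'k::topological_space \<Rightarrow>\<^sub>C 'x::real_normed_vector"
  assumes K: "compact (UNIV :: 'k set)" and e: "0 < e"
  shows "\<exists>g \<in> span (range (\<lambda>(a, x). pscale a (const_bcontfun x))). norm (f - g) \<le> e"
proof -
  have cf: "continuous_on UNIV (apply_bcontfun f)"
    by (simp add: continuous_on_apply_bcontfun)
  then have "compact (range (apply_bcontfun f))"
    using K compact_continuous_image by blast
  from compact_imp_seq_compact[OF this, THEN seq_compact_imp_totally_bounded, rule_format, OF e]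
  obtain D where D: "finite D" "range (apply_bcontfun f) \<subseteq> (\<Union>x\<in>D. ball x e)"
    by (elim exE conjE)
  define p where "p x t = max 0 (e - dist x (apply_bcontfun f t))" for x t
  define s where "s t = (\<Sum>x\<in>D. p x t)" for t
  have p0: "0 \<le> p x t" for x t by (simp add: p_def)
  have s0: "0 < s t" for t
  proof -
    obtain x where "x \<in> D" "dist x (apply_bcontfun f t) < e"
      using D(2) by (auto simp: subset_iff image_iff)
    then show ?thesis
      unfolding s_def using D(1) p0 by (intro sum_pos2[of D x]) (auto simp: p_def)
  qed
  have cp: "continuous_on UNIV (p x)" for x
    unfolding p_def[abs_def] by (intro continuous_intros cf)
  have "continuous_on UNIV (\<lambda>t. p x t / s t)" for x
    unfolding s_def[abs_def] using s0
    by (intro continuous_intros cp) (auto simp: s_def less_le)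
  then have w: "apply_bcontfun (Bcontfun (\<lambda>t. p x t / s t)) = (\<lambda>t. p x t / s t)" for x
    by (rule apply_Bcontfun_compact[OF K])
  define g where
    "g = (\<Sum>x\<in>D. pscale (Bcontfun (\<lambda>t. p x t / s t)) (const_bcontfun x))"
  have g: "apply_bcontfun g t = (\<Sum>x\<in>D. (p x t / s t) *\<^sub>R x)" for t
    unfolding g_def using D(1) by (induction D rule: finite_induct) (auto simp: w)
  have "norm (apply_bcontfun (f - g) t) \<le> e" for t
  proof -
    have one: "(\<Sum>x\<in>D. p x t / s t) = 1"
      using s0[of t] by (simp add: sum_divide_distrib[symmetric] s_def)
    have "apply_bcontfun (f - g) t = (\<Sum>x\<in>D. (p x t / s t) *\<^sub>R (apply_bcontfun f t - x))"
      by (simp add: g one scaleR_diff_right sum_subtractf scaleR_sum_left[symmetric])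
    also have "norm \<dots> \<le> (\<Sum>x\<in>D. (p x t / s t) * e)"
    proof (rule sum_norm_le)
      fix x assume "x \<in> D"
      show "norm ((p x t / s t) *\<^sub>R (apply_bcontfun f t - x)) \<le> (p x t / s t) * e"
      proof (cases "dist x (apply_bcontfun f t) \<le> e")
        case True
        then have "norm (apply_bcontfun f t - x) \<le> e"
          by (simp add: dist_norm norm_minus_commute)
        then show ?thesis using p0[of x t] s0[of t]
          by (auto intro!: divide_right_mono mult_left_mono)
      next
        case False
        then show ?thesis by (simp add: p_def)
      qed
    qed
    also have "\<dots> = e" unfolding sum_distrib_right[symmetric] one by simp
    finally show ?thesis .
  qed
  then have "norm (f - g) \<le> e" by (rule norm_bound)
  moreover have "g \<in> span (range (\<lambda>(a, x). pscale a (const_bcontfun x)))"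
    unfolding g_def by (intro span_sum span_base) auto
  ultimately show ?thesis by blast
qed

section \<open>Linear maps\<close>

text \<open>
  For independent \<open>x\<close> and \<open>x0\<close>, the eigenvalue of \<open>x + x0\<close> must agree with the eigenvalues of both.
\<close>

lemma linear_eigenvectors_imp_scalar:
  fixes f :: "'x::real_vector \<Rightarrow> 'x"
  assumes f: "linear f" and ev: "\<And>x. \<exists>c. f x = c *\<^sub>R x"
  shows "\<exists>c. \<forall>x. f x = c *\<^sub>R x"
proof (cases "\<forall>x::'x. x = 0")
  case True
  then show ?thesis by metis
next
  case False
  then obtain x0 :: 'x where x0: "x0 \<noteq> 0" by blast
  obtain c where c: "f x0 = c *\<^sub>R x0" using ev by blast
  have "f x = c *\<^sub>R x" for x
  proof (cases "\<exists>r. x = r *\<^sub>R x0")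
    case True
    then show ?thesis using c by (auto simp: linear_scale[OF f])
  next
    case False
    obtain d where d: "f x = d *\<^sub>R x" using ev by blast
    obtain e where e: "f (x + x0) = e *\<^sub>R (x + x0)" using ev by blast
    have eq: "(d - e) *\<^sub>R x = (e - c) *\<^sub>R x0"
      using e by (simp add: linear_add[OF f] c d algebra_simps)
    have "d = e"
    proof (rule ccontr)
      assume "d \<noteq> e"
      then have "x = ((e - c) / (d - e)) *\<^sub>R x0"
        using eq by (metis (no_types, opaque_lifting) divide_inverse_commute eq_iff_diff_eq_0
            scaleR_scaleR scaleR_one left_inverse)
      with False show False by blast
    qed
    with eq x0 have "e = c" by simp
    with \<open>d = e\<close> d show ?thesis by simp
  qed
  then show ?thesis by blast
qed

lemma blinfun_eq_on_closure_span:
  fixes S T :: "'e::real_normed_vector \<Rightarrow>\<^sub>L 'g::real_normed_vector"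
  assumes eq: "\<And>y. y \<in> A \<Longrightarrow> blinfun_apply S y = blinfun_apply T y"
    and dense: "closure (span A) = UNIV"
  shows "S = T"
proof (rule blinfun_eqI)
  fix y
  have "closed {y. blinfun_apply S y = blinfun_apply T y}"
    by (intro closed_Collect_eq blinfun.continuous_on continuous_on_const continuous_on_id)
  moreover have "span A \<subseteq> {y. blinfun_apply S y = blinfun_apply T y}"
    by (intro span_minimal subspaceI)
      (auto simp: eq blinfun.add_right blinfun.scaleR_right blinfun.zero_right)
  ultimately have "closure (span A) \<subseteq> {y. blinfun_apply S y = blinfun_apply T y}"
    by (rule closure_minimal[rotated])
  with dense show "blinfun_apply S y = blinfun_apply T y" by blast
qed

section \<open>A Banach lattice that is cyclic over its center\<close>

locale cyclic_banach_lattice =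
  fixes J :: "('k::t2_space \<Rightarrow>\<^sub>C real) \<Rightarrow> ('f::banach_lattice \<Rightarrow>\<^sub>L 'f)" and u :: 'f
  assumes compact_K: "compact (UNIV :: 'k set)"
    and J: "center_identification J"
    and u: "quasi_interior u" and norm_u: "norm u = 1"
begin

lemma u_nonneg: "0 \<le> u"
  using u by (simp add: quasi_interior_def)

lemma linear_J: "linear J"
  using J by (simp add: center_identification_def)

lemma range_J: "range J = ideal_center"
  using J by (simp add: center_identification_def bij_betw_def)

lemma J_pscale: "blinfun_apply (J (pscale a b)) x = blinfun_apply (J a) (blinfun_apply (J b) x)"
  using J by (simp add: center_identification_def)

lemma norm_J: "norm (J a) = norm a"
  using J by (simp add: center_identification_def)

lemma J_mono:
  assumes "\<And>t. apply_bcontfun a t \<le> apply_bcontfun b t" "0 \<le> x"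
  shows "blinfun_apply (J a) x \<le> blinfun_apply (J b) x"
  using J assms unfolding center_identification_def by blast

lemma J_const: "blinfun_apply (J (const_bcontfun c)) x = c *\<^sub>R x"
proof -
  have "const_bcontfun c = c *\<^sub>R (const_bcontfun 1 :: 'k \<Rightarrow>\<^sub>C real)"
    by (rule bcontfun_eqI) simp
  moreover have "J (const_bcontfun 1) = id_blinfun"
    using J by (simp add: center_identification_def)
  ultimately show ?thesis
    by (simp add: linear_scale[OF linear_J] blinfun.scaleR_left)
qed

lemma norm_J_apply_le: "norm (blinfun_apply (J a) x) \<le> norm a * norm x"
  using norm_blinfun[of "J a" x] by (simp add: norm_J)

lemma abs_J_le:
  assumes "\<And>t. \<bar>apply_bcontfun a t\<bar> \<le> apply_bcontfun b t" "0 \<le> x"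
  shows "\<bar>blinfun_apply (J a) x\<bar> \<le> blinfun_apply (J b) x"
proof (rule abs_leI)
  show "blinfun_apply (J a) x \<le> blinfun_apply (J b) x"
    using assms abs_le_iff by (intro J_mono) blast+
  have "blinfun_apply (J (- a)) x \<le> blinfun_apply (J b) x"
    using assms by (intro J_mono) (auto simp: abs_le_iff)
  then show "- blinfun_apply (J a) x \<le> blinfun_apply (J b) x"
    by (simp add: linear_neg[OF linear_J] blinfun.minus_left)
qed

lemma apply_Bcontfun_comp:
  fixes \<phi> :: "real \<Rightarrow> real"
  assumes "continuous_on UNIV \<phi>"
  shows "apply_bcontfun (Bcontfun (\<lambda>t::'k. \<phi> (apply_bcontfun b t))) = (\<lambda>t. \<phi> (apply_bcontfun b t))"
  by (intro apply_Bcontfun_compact[OF compact_K] continuous_on_compose2[OF assms])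
    (auto simp: continuous_on_apply_bcontfun)

text \<open>
  Multiplying \<open>b\<close> by a continuous approximation \<open>s\<close> of its sign gives \<open>\<bar>b\<bar>\<close> up to \<open>e\<close>, and \<open>J s\<close> is
  a contraction; let \<open>e\<close> tend to zero.
\<close>

lemma norm_J_norm_fun: "norm (blinfun_apply (J (norm_fun b)) u) = norm (blinfun_apply (J b) u)"
proof (rule antisym)
  show "norm (blinfun_apply (J (norm_fun b)) u) \<le> norm (blinfun_apply (J b) u)"
  proof (rule field_le_epsilon)
    fix e :: real assume e: "0 < e"
    \<comment> \<open>\<open>s\<close> is a continuous approximation of the sign of \<open>b\<close>.\<close>
    define s where "s = Bcontfun (\<lambda>t. apply_bcontfun b t / max \<bar>apply_bcontfun b t\<bar> e)"
    have s: "apply_bcontfun s = (\<lambda>t. apply_bcontfun b t / max \<bar>apply_bcontfun b t\<bar> e)"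
      unfolding s_def using e
      by (intro apply_Bcontfun_comp[of "\<lambda>r. r / max \<bar>r\<bar> e"] continuous_intros) auto
    have "norm (apply_bcontfun s t) \<le> 1" for t
      using e by (auto simp: s abs_mult divide_le_eq)
    then have "norm s \<le> 1" by (rule norm_bound)
    have "\<bar>r\<bar> \<le> r / max \<bar>r\<bar> e * r + e" for r :: real
    proof (cases "\<bar>r\<bar> \<le> e")
      case True
      moreover have "0 \<le> r / max \<bar>r\<bar> e * r" using e by simp
      ultimately show ?thesis by linarith
    next
      case False
      then have "r / max \<bar>r\<bar> e * r = \<bar>r\<bar>"
        using e by (auto simp: max_def abs_if)
      then show ?thesis using e by simp
    qed
    then have "\<bar>blinfun_apply (J (norm_fun b)) u\<bar> \<le> blinfun_apply (J (pscale s b + const_bcontfun e)) u"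
      by (intro abs_J_le u_nonneg) (simp add: s)
    then have "norm (blinfun_apply (J (norm_fun b)) u) \<le>
        norm (blinfun_apply (J (pscale s b + const_bcontfun e)) u)"
      by (rule norm_mono_banach_lattice)
    also have "\<dots> = norm (blinfun_apply (J s) (blinfun_apply (J b) u) + e *\<^sub>R u)"
      by (simp add: linear_add[OF linear_J] blinfun.add_left J_pscale J_const)
    also have "\<dots> \<le> norm (blinfun_apply (J s) (blinfun_apply (J b) u)) + e"
      using e by (intro norm_triangle_le) (simp add: norm_u)
    also have "\<dots> \<le> norm (blinfun_apply (J b) u) + e"
      using norm_J_apply_le[of s "blinfun_apply (J b) u"] \<open>norm s \<le> 1\<close>
        mult_right_mono[OF \<open>norm s \<le> 1\<close>, of "norm (blinfun_apply (J b) u)"] by simp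
    finally show "norm (blinfun_apply (J (norm_fun b)) u) \<le> norm (blinfun_apply (J b) u) + e" .
  qed
  show "norm (blinfun_apply (J b) u) \<le> norm (blinfun_apply (J (norm_fun b)) u)"
    by (intro norm_mono_banach_lattice abs_J_le u_nonneg) simp
qed

lemma norm_J_u_mono:
  assumes "\<And>t. \<bar>apply_bcontfun a t\<bar> \<le> \<bar>apply_bcontfun b t\<bar>"
  shows "norm (blinfun_apply (J a) u) \<le> norm (blinfun_apply (J b) u)"
proof -
  have "norm (blinfun_apply (J a) u) \<le> norm (blinfun_apply (J (norm_fun b)) u)"
    using assms by (intro norm_mono_banach_lattice abs_J_le u_nonneg) simp
  then show ?thesis by (simp add: norm_J_norm_fun)
qed

lemma J_u_approx:
  assumes "0 < e"
  shows "\<exists>b. norm (x - blinfun_apply (J b) u) < e"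
proof -
  have "x \<in> closure ((\<lambda>S. blinfun_apply S u) ` range J)"
    using u by (simp add: quasi_interior_def range_J)
  then obtain b where "dist (blinfun_apply (J b) u) x < e"
    using assms by (force simp: closure_approachable)
  then show ?thesis by (auto simp: dist_norm norm_minus_commute)
qed

lemma J_u_commute:
  "blinfun_apply (J a) (blinfun_apply (J b) u) = blinfun_apply (J b) (blinfun_apply (J a) u)"
proof -
  have "pscale a b = pscale b a" by (rule bcontfun_eqI) (simp add: mult.commute)
  then show ?thesis by (simp add: J_pscale[symmetric])
qed

text \<open>
  If \<open>J a\<close> annihilates \<open>u\<close>, then it annihilates the dense subspace of all \<open>J b u\<close>, because the center
  is commutative.
\<close>

lemma J_u_eq_0:
  assumes "blinfun_apply (J a) u = 0"
  shows "a = 0"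
proof -
  have "closure (span (range (\<lambda>b. blinfun_apply (J b) u))) = UNIV"
  proof -
    have "closure (range (\<lambda>b. blinfun_apply (J b) u)) = UNIV"
      using u by (simp add: quasi_interior_def range_J[symmetric] image_image)
    then show ?thesis
      using closure_mono[OF span_superset[of "range (\<lambda>b. blinfun_apply (J b) u)"]] by blast
  qed
  then have "J a = 0"
    by (rule blinfun_eq_on_closure_span[rotated])
      (auto simp: J_u_commute[of a] assms blinfun.zero_right)
  then show ?thesis using norm_J[of a] by simp
qed

text \<open>
  The operators \<open>J (d n)\<close>
  converge on every vector \<open>J b u\<close>, since they commute with \<open>J b\<close>; being uniformly bounded, they then
  converge on all of \<open>F\<close>, and the bound \<open>\<bar>J (d n) x\<bar> \<le> c x\<close> for
  \<open>0 \<le> x\<close> passes to the limit operator, which therefore belongs to the ideal center, the range of \<open>J\<close>.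
\<close>

lemma J_u_limit:
  assumes d: "\<And>n t. \<bar>apply_bcontfun (d n) t\<bar> \<le> c" and c: "0 < c"
    and lim: "(\<lambda>n. blinfun_apply (J (d n)) u) \<longlonglongrightarrow> v"
  shows "\<exists>a. v = blinfun_apply (J a) u"
proof -
  have nd: "norm (J (d n)) \<le> c" for n
    using norm_bound[of "d n" c] d by (simp add: norm_J)
  have le: "norm (blinfun_apply (J (d n)) x) \<le> c * norm x" for n x
    using norm_blinfun[of "J (d n)" x] nd[of n]
    by (meson mult_right_mono norm_ge_zero order_trans)
  have "Cauchy (\<lambda>n. blinfun_apply (J (d n)) x)" for x
  proof (rule metric_CauchyI)
    fix e :: real assume e: "0 < e"
    \<comment> \<open>Replacing \<open>x\<close> by a \<open>\<delta>\<close>-close \<open>y\<close> moves each image by at most \<open>c * \<delta> = e / 4\<close>.\<close>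
    define \<delta> where "\<delta> = e / (4 * c)"
    have "0 < \<delta>" using e c by (simp add: \<delta>_def)
    then obtain b where b: "norm (x - blinfun_apply (J b) u) < \<delta>" using J_u_approx by blast
    define y where "y = blinfun_apply (J b) u"
    have "(\<lambda>n. blinfun_apply (J b) (blinfun_apply (J (d n)) u)) \<longlonglongrightarrow> blinfun_apply (J b) v"
      by (rule blinfun.tendsto[OF tendsto_const lim])
    then have "Cauchy (\<lambda>n. blinfun_apply (J (d n)) y)"
      by (simp add: y_def J_u_commute[of "d _"] LIMSEQ_imp_Cauchy)
    then obtain M where M: "\<And>m n. m \<ge> M \<Longrightarrow> n \<ge> M \<Longrightarrow>
        norm (blinfun_apply (J (d m)) y - blinfun_apply (J (d n)) y) < e / 2"
      using e by (metis CauchyD half_gt_zero)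
    have small: "norm (blinfun_apply (J (d n)) (x - y)) \<le> e / 4" for n
      using le[of n "x - y"] b c mult_left_mono[of "norm (x - y)" \<delta> c]
      by (simp add: y_def[symmetric] \<delta>_def)
    have "dist (blinfun_apply (J (d m)) x) (blinfun_apply (J (d n)) x) < e"
      if "m \<ge> M" "n \<ge> M" for m n
    proof -
      have "blinfun_apply (J (d m)) x - blinfun_apply (J (d n)) x =
          (blinfun_apply (J (d m)) y - blinfun_apply (J (d n)) y)
          + (blinfun_apply (J (d m)) (x - y) - blinfun_apply (J (d n)) (x - y))"
        by (simp add: blinfun.diff_right)
      then show ?thesis
        using M[OF that] small[of m] small[of n]
          norm_triangle_ineq[of "blinfun_apply (J (d m)) y - blinfun_apply (J (d n)) y"
            "blinfun_apply (J (d m)) (x - y) - blinfun_apply (J (d n)) (x - y)"]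
          norm_triangle_ineq4[of "blinfun_apply (J (d m)) (x - y)" "blinfun_apply (J (d n)) (x - y)"]
        unfolding dist_norm by simp
    qed
    then show "\<exists>M. \<forall>m\<ge>M. \<forall>n\<ge>M. dist (blinfun_apply (J (d m)) x) (blinfun_apply (J (d n)) x) < e"
      by blast
  qed
  then obtain S where S: "\<And>x. (\<lambda>n. blinfun_apply (J (d n)) x) \<longlonglongrightarrow> S x"
    unfolding Cauchy_convergent_iff convergent_def by metis
  have "bounded_linear S"
  proof (rule bounded_linear_intro[where K = c])
    fix x y :: 'f and r :: real
    show "S (x + y) = S x + S y"
      using S[of "x + y"] tendsto_add[OF S[of x] S[of y]]
      by (simp add: blinfun.add_right LIMSEQ_unique)
    show "S (r *\<^sub>R x) = r *\<^sub>R S x"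
      using S[of "r *\<^sub>R x"] tendsto_scaleR[OF tendsto_const[of r] S[of x]]
      by (simp add: blinfun.scaleR_right LIMSEQ_unique)
    show "norm (S x) \<le> norm x * c"
      using le[of _ x] by (intro LIMSEQ_le_const2[OF tendsto_norm[OF S]]) (simp add: mult.commute)
  qed
  then have apply_S: "blinfun_apply (Blinfun S) = S" by (rule bounded_linear_Blinfun_apply)
  have "\<bar>S x\<bar> \<le> c *\<^sub>R x" if x: "0 \<le> x" for x
  proof (rule tendsto_le_banach_lattice)
    show "(\<lambda>n. \<bar>blinfun_apply (J (d n)) x\<bar>) \<longlonglongrightarrow> \<bar>S x\<bar>"
      by (rule tendsto_abs_banach_lattice[OF S])
    show "(\<lambda>n. c *\<^sub>R x) \<longlonglongrightarrow> c *\<^sub>R x" by simp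
    show "\<bar>blinfun_apply (J (d n)) x\<bar> \<le> c *\<^sub>R x" for n
      using abs_J_le[of "d n" "const_bcontfun c" x] d x by (simp add: J_const)
  qed
  then have "Blinfun S \<in> range J"
    unfolding range_J ideal_center_def using c by (auto simp: apply_S)
  then obtain a where "Blinfun S = J a" by blast
  then have "S u = blinfun_apply (J a) u" by (metis apply_S)
  then show ?thesis using LIMSEQ_unique[OF lim S] by blast
qed

text \<open>
  An analogue of the Radon-Nikodym theorem with bounded density: \<open>v\<close> is approximated by
  \<open>J (b n) u\<close>, and \<open>b n\<close> is truncated at the level \<open>k = c + 1\<close>. The function \<open>e n\<close> vanishes where
  \<open>\<bar>b n\<bar> \<le> k\<close>, and its product with \<open>b n\<close> is exactly the part that truncation removes. Where
  \<open>e n\<close> is nonzero, the values of \<open>\<bar>b n\<bar>\<close> exceed \<open>k\<close>, while the hypothesis only allows a factor \<open>c\<close> up to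
  the approximation error; the gap \<open>k - c = 1\<close> bounds the removed part by \<open>k\<close> times that error.
\<close>

lemma dominated_imp_J_u:
  assumes dom: "\<And>a. norm (blinfun_apply (J a) v) \<le> c * norm (blinfun_apply (J a) u)"
  shows "\<exists>a. v = blinfun_apply (J a) u"
proof -
  have "0 \<le> c"
    using dom[of "const_bcontfun 1"] by (simp add: J_const norm_u order_trans[OF norm_ge_zero])
  define k where "k = c + 1"
  have k: "0 < k" using \<open>0 \<le> c\<close> by (simp add: k_def)
  obtain b where b: "\<And>n. norm (v - blinfun_apply (J (b n)) u) < inverse (real (Suc n))"
    using J_u_approx[of "inverse (real (Suc _))" v]
    by (metis inverse_positive_iff_positive of_nat_0_less_iff zero_less_Suc)
  have b_lim: "(\<lambda>n. v - blinfun_apply (J (b n)) u) \<longlonglongrightarrow> 0"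
    using b by (intro Lim_null_comparison[OF _ LIMSEQ_inverse_real_of_nat])
      (auto intro!: always_eventually less_imp_le)
  define e where "e n = Bcontfun (\<lambda>t. 1 - k / max \<bar>apply_bcontfun (b n) t\<bar> k)" for n
  have e: "apply_bcontfun (e n) = (\<lambda>t. 1 - k / max \<bar>apply_bcontfun (b n) t\<bar> k)" for n
    unfolding e_def using k
    by (intro apply_Bcontfun_comp[of "\<lambda>r. 1 - k / max \<bar>r\<bar> k"] continuous_intros) auto
  have ne: "norm (e n) \<le> 1" for n
    using k by (intro norm_bound) (auto simp: e abs_le_iff divide_le_eq field_simps)
  define d where "d n = b n - pscale (e n) (b n)" for n
  have d: "\<bar>apply_bcontfun (d n) t\<bar> \<le> k" for n t
    using k by (auto simp: d_def e algebra_simps abs_mult max_def divide_le_eq)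
  have tail: "norm (blinfun_apply (J (pscale (e n) (b n))) u) \<le>
      k * norm (v - blinfun_apply (J (b n)) u)" for n
  proof -
    let ?\<delta> = "norm (v - blinfun_apply (J (b n)) u)" and ?E = "norm (blinfun_apply (J (e n)) u)"
    let ?P = "norm (blinfun_apply (J (pscale (e n) (b n))) u)"
    have "blinfun_apply (J (pscale (e n) (b n))) u =
        blinfun_apply (J (e n)) v - blinfun_apply (J (e n)) (v - blinfun_apply (J (b n)) u)"
      by (simp add: J_pscale blinfun.diff_right)
    then have "?P \<le> norm (blinfun_apply (J (e n)) v)
        + norm (blinfun_apply (J (e n)) (v - blinfun_apply (J (b n)) u))"
      by (metis norm_triangle_ineq4)
    also have "\<dots> \<le> c * ?E + ?\<delta>"
    proof (rule add_mono[OF dom])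
      show "norm (blinfun_apply (J (e n)) (v - blinfun_apply (J (b n)) u)) \<le> ?\<delta>"
        using norm_J_apply_le[of "e n" "v - blinfun_apply (J (b n)) u"]
          mult_right_mono[OF ne[of n] norm_ge_zero[of "v - blinfun_apply (J (b n)) u"]] by simp
    qed
    finally have upper: "?P \<le> c * ?E + ?\<delta>" .
    have "norm (blinfun_apply (J (k *\<^sub>R e n)) u) \<le> ?P"
    proof (rule norm_J_u_mono)
      fix t
      have "k * \<bar>1 - k / max \<bar>r\<bar> k\<bar> \<le> \<bar>1 - k / max \<bar>r\<bar> k\<bar> * \<bar>r\<bar>" for r :: real
        using k by (cases "\<bar>r\<bar> \<le> k") (auto simp: max_def mult.commute intro!: mult_right_mono)
      then show "\<bar>apply_bcontfun (k *\<^sub>R e n) t\<bar> \<le> \<bar>apply_bcontfun (pscale (e n) (b n)) t\<bar>"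
        using k by (simp add: e abs_mult)
    qed
    then have "k * ?E \<le> ?P"
      using k by (simp add: linear_scale[OF linear_J] blinfun.scaleR_left)
    with upper have "?E \<le> ?\<delta>" by (simp add: k_def algebra_simps)
    then have "c * ?E \<le> c * ?\<delta>" using \<open>0 \<le> c\<close> by (rule mult_left_mono)
    with upper have "?P \<le> c * ?\<delta> + ?\<delta>" by linarith
    then show ?thesis by (simp add: k_def algebra_simps)
  qed
  have "(\<lambda>n. k * norm (v - blinfun_apply (J (b n)) u)) \<longlonglongrightarrow> 0"
    using tendsto_mult[OF tendsto_const tendsto_norm[OF b_lim], of k] by simp
  then have "(\<lambda>n. blinfun_apply (J (pscale (e n) (b n))) u) \<longlonglongrightarrow> 0"
    by (rule Lim_null_comparison[OF always_eventually[OF allI[OF tail]]])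
  from tendsto_diff[OF tendsto_diff[OF tendsto_const[of v] b_lim] this]
  have "(\<lambda>n. blinfun_apply (J (d n)) u) \<longlonglongrightarrow> v"
    by (simp add: d_def linear_diff[OF linear_J] blinfun.diff_left)
  from J_u_limit[OF d k this] show ?thesis .
qed

end

section \<open>The completion and its cyclic subspaces\<close>

locale vector_valued_lattice = cyclic_banach_lattice J u
  for J :: "('k::t2_space \<Rightarrow>\<^sub>C real) \<Rightarrow> ('f::banach_lattice \<Rightarrow>\<^sub>L 'f)" and u :: 'f +
  fixes \<iota> :: "('k \<Rightarrow>\<^sub>C 'x::banach) \<Rightarrow> 'e::banach"
  assumes completion: "is_completion (F_norm J u) \<iota>"
begin

lemma linear_\<iota>: "linear \<iota>"
  using completion by (simp add: is_completion_def)

lemma norm_\<iota>: "norm (\<iota> f) = norm (blinfun_apply (J (norm_fun f)) u)"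
  using completion by (simp add: is_completion_def F_norm_def)

lemma module_action_\<iota>: "blinfun_apply (module_action \<iota> a) (\<iota> f) = \<iota> (pscale a f)"
  using theI'[OF module_action_ex1[OF J u_nonneg completion, of a]]
  by (simp add: module_action_def)

lemma inj_\<iota>: "\<iota> f = \<iota> g \<longleftrightarrow> f = g"
proof
  assume "\<iota> f = \<iota> g"
  then have "norm (\<iota> (f - g)) = 0" by (simp add: linear_diff[OF linear_\<iota>])
  then have "norm_fun (f - g) = 0" by (simp add: norm_\<iota> J_u_eq_0)
  then have "apply_bcontfun (norm_fun (f - g)) t = 0" for t by simp
  then show "f = g" by (intro bcontfun_eqI) simp
qed simp

lemma norm_\<iota>_le: "norm (\<iota> f) \<le> norm f"
proof -
  have "norm (norm_fun f) \<le> norm f" by (intro norm_bound) (simp add: norm_bounded)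
  then show ?thesis using norm_J_apply_le[of "norm_fun f" u] by (simp add: norm_\<iota> norm_u)
qed

text \<open>
  Up to the factor \<open>\<parallel>x\<parallel>\<close>, the map \<open>J a u \<mapsto> \<iota>(a x)\<close> is an isometry: this identifies the cyclic subspace
  of a nonzero \<open>x\<close> with \<open>F\<close>.
\<close>

lemma norm_\<iota>_tensor:
  "norm (\<iota> (pscale a (const_bcontfun x))) = norm x * norm (blinfun_apply (J a) u)"
proof -
  have "norm_fun (pscale a (const_bcontfun x)) = norm x *\<^sub>R norm_fun a"
    by (rule bcontfun_eqI) simp
  then show ?thesis
    by (simp add: norm_\<iota> linear_scale[OF linear_J] blinfun.scaleR_left norm_J_norm_fun)
qed

lemma closure_span_tensors:
  "closure (span (range (\<lambda>(a, x). \<iota> (pscale a (const_bcontfun x))))) = UNIV"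
proof -
  let ?T = "range (\<lambda>(a, x). pscale a (const_bcontfun x)) :: ('k \<Rightarrow>\<^sub>C 'x) set"
  have eq: "span (range (\<lambda>(a, x). \<iota> (pscale a (const_bcontfun x)))) = \<iota> ` span ?T"
    by (simp add: linear_span_image[OF linear_\<iota>, symmetric] image_image case_prod_unfold)
  have "range \<iota> \<subseteq> closure (\<iota> ` span ?T)"
  proof clarify
    fix f
    show "\<iota> f \<in> closure (\<iota> ` span ?T)"
      unfolding closure_approachable
    proof (intro allI impI)
      fix e :: real assume e: "0 < e"
      obtain g where g: "g \<in> span ?T" "norm (f - g) \<le> e / 2"
        using simple_tensors_dense[OF compact_K, of "e / 2" f] e by auto
      then have "dist (\<iota> g) (\<iota> f) < e"
        using norm_\<iota>_le[of "f - g"] e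
        by (simp add: dist_norm norm_minus_commute[of "\<iota> g"] linear_diff[OF linear_\<iota>])
      then show "\<exists>y\<in>\<iota> ` span ?T. dist y (\<iota> f) < e" using g by blast
    qed
  qed
  then have "closure (range \<iota>) \<subseteq> closure (\<iota> ` span ?T)"
    by (simp add: closure_minimal)
  then show ?thesis using completion unfolding eq is_completion_def by auto
qed

lemma module_action_commute:
  "blinfun_apply (module_action \<iota> a) (blinfun_apply (module_action \<iota> b) y) =
   blinfun_apply (module_action \<iota> b) (blinfun_apply (module_action \<iota> a) y)"
proof -
  have "module_action \<iota> a o\<^sub>L module_action \<iota> b = module_action \<iota> b o\<^sub>L module_action \<iota> a"
    by (rule blinfun_eq_on_closure_span[OF _ closure_span_tensors])
      (auto simp: module_action_\<iota> pscale_commute[of a])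
  then show ?thesis by (metis blinfun_apply_blinfun_compose)
qed

lemma module_action_cyclic_subspace:
  "blinfun_apply (module_action \<iota> a) ` cyclic_subspace \<iota> x \<subseteq> cyclic_subspace \<iota> x"
proof -
  have "blinfun_apply (module_action \<iota> a) ` cyclic_subspace \<iota> x \<subseteq>
      closure (blinfun_apply (module_action \<iota> a) ` range (\<lambda>b. \<iota> (pscale b (const_bcontfun x))))"
    unfolding cyclic_subspace_def
    by (rule closure_bounded_linear_image_subset) (rule blinfun.bounded_linear_right)
  also have "\<dots> \<subseteq> cyclic_subspace \<iota> x"
    unfolding cyclic_subspace_def by (rule closure_mono) (auto simp: module_action_\<iota> pscale_pscale)
  finally show ?thesis .
qed

lemma const_in_cyclic_subspace: "\<iota> (const_bcontfun x) \<in> cyclic_subspace \<iota> x"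
  unfolding cyclic_subspace_def
  by (rule subsetD[OF closure_subset]) (metis pscale_one rangeI)

text \<open>
  The statement \<open>dominated_imp_J_u\<close>, carried over from \<open>F\<close> to the cyclic subspace of \<open>x\<close>.
\<close>

lemma dominated_in_cyclic_subspace:
  assumes y: "y \<in> cyclic_subspace \<iota> x"
    and dom: "\<And>a. norm (blinfun_apply (module_action \<iota> a) y) \<le>
      c * norm (\<iota> (pscale a (const_bcontfun x)))"
  shows "\<exists>a. y = \<iota> (pscale a (const_bcontfun x))"
proof (cases "x = 0")
  case True
  then have zero: "\<iota> (pscale a (const_bcontfun x)) = 0" for a
    by (simp add: linear_0[OF linear_const_bcontfun] linear_0[OF linear_pscale_right]
        linear_0[OF linear_\<iota>])
  with y have "y = 0" by (simp add: cyclic_subspace_def)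
  with zero show ?thesis by simp
next
  case False
  obtain s :: "nat \<Rightarrow> 'e"
    where "\<forall>n. s n \<in> range (\<lambda>a. \<iota> (pscale a (const_bcontfun x)))" and s: "s \<longlonglongrightarrow> y"
    using y unfolding cyclic_subspace_def closure_sequential by blast
  then have "\<forall>n. \<exists>a. s n = \<iota> (pscale a (const_bcontfun x))" by blast
  from choice[OF this] obtain b where "\<forall>n. s n = \<iota> (pscale (b n) (const_bcontfun x))" by blast
  then have "s = (\<lambda>n. \<iota> (pscale (b n) (const_bcontfun x)))" by blast
  with s have b: "(\<lambda>n. \<iota> (pscale (b n) (const_bcontfun x))) \<longlonglongrightarrow> y" by simp
  have dist_eq: "norm (\<iota> (pscale a (const_bcontfun x)) - \<iota> (pscale a' (const_bcontfun x))) =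
      norm x * norm (blinfun_apply (J a) u - blinfun_apply (J a') u)" for a a'
    using norm_\<iota>_tensor[of "a - a'" x]
    by (simp add: linear_diff[OF linear_pscale_left] linear_diff[OF linear_\<iota>]
        linear_diff[OF linear_J] blinfun.diff_left)
  have "Cauchy (\<lambda>n. blinfun_apply (J (b n)) u)"
  proof (rule CauchyI)
    fix e :: real assume "0 < e"
    with False have "0 < norm x * e" by simp
    with LIMSEQ_imp_Cauchy[OF b] obtain M where
      "\<And>m n. m \<ge> M \<Longrightarrow> n \<ge> M \<Longrightarrow>
        norm x * norm (blinfun_apply (J (b m)) u - blinfun_apply (J (b n)) u) < norm x * e"
      unfolding dist_eq[symmetric] using CauchyD by blast
    with False show "\<exists>M. \<forall>m\<ge>M. \<forall>n\<ge>M.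
        norm (blinfun_apply (J (b m)) u - blinfun_apply (J (b n)) u) < e"
      by (metis mult_less_cancel_left_pos zero_less_norm_iff)
  qed
  then obtain v where v: "(\<lambda>n. blinfun_apply (J (b n)) u) \<longlonglongrightarrow> v"
    by (auto simp: Cauchy_convergent_iff convergent_def)
  have "norm (blinfun_apply (J a) v) \<le> c * norm (blinfun_apply (J a) u)" for a
  proof -
    have "(\<lambda>n. norm x * norm (blinfun_apply (J a) (blinfun_apply (J (b n)) u)))
        \<longlonglongrightarrow> norm x * norm (blinfun_apply (J a) v)"
      by (intro tendsto_intros blinfun.tendsto v)
    moreover have "(\<lambda>n. norm (blinfun_apply (module_action \<iota> a) (\<iota> (pscale (b n) (const_bcontfun x)))))
        \<longlonglongrightarrow> norm (blinfun_apply (module_action \<iota> a) y)"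
      by (intro tendsto_intros blinfun.tendsto b)
    ultimately have "norm x * norm (blinfun_apply (J a) v) = norm (blinfun_apply (module_action \<iota> a) y)"
      by (simp add: module_action_\<iota> pscale_pscale norm_\<iota>_tensor J_pscale LIMSEQ_unique)
    with dom[of a]
    have "norm x * norm (blinfun_apply (J a) v) \<le> norm x * (c * norm (blinfun_apply (J a) u))"
      by (simp add: norm_\<iota>_tensor mult.left_commute)
    with False show ?thesis by (metis mult_le_cancel_left_pos zero_less_norm_iff)
  qed
  then obtain a where "v = blinfun_apply (J a) u" using dominated_imp_J_u by blast
  with v have "(\<lambda>n. norm x * norm (blinfun_apply (J (b n)) u - blinfun_apply (J a) u)) \<longlonglongrightarrow> norm x * 0"
    by (intro tendsto_intros) (simp add: tendsto_norm_zero_iff LIM_zero_iff)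
  then have "(\<lambda>n. \<iota> (pscale (b n) (const_bcontfun x))) \<longlonglongrightarrow> \<iota> (pscale a (const_bcontfun x))"
    by (simp add: dist_eq[symmetric] tendsto_norm_zero_iff LIM_zero_iff)
  with b show ?thesis using LIMSEQ_unique by blast
qed

text \<open>
  On each constant function \<open>x\<close>, the operator is multiplication by some \<open>\<alpha> x\<close>, since commuting with
  \<open>C(K)\<close> makes the image of \<open>x\<close> dominated by \<open>x\<close>. Linearity in \<open>x\<close>, read off pointwise because
  \<open>\<iota>\<close> is injective, makes \<open>\<alpha> x\<close> independent of \<open>x \<noteq> 0\<close>.
\<close>

lemma multiplication_operatorI:
  fixes T :: "'e \<Rightarrow>\<^sub>L 'e"
  assumes inv: "\<And>x. blinfun_apply T ` cyclic_subspace \<iota> x \<subseteq> cyclic_subspace \<iota> x"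
    and comm: "\<And>x a g. g \<in> cyclic_subspace \<iota> x \<Longrightarrow>
      blinfun_apply T (blinfun_apply (module_action \<iota> a) g) =
      blinfun_apply (module_action \<iota> a) (blinfun_apply T g)"
  shows "\<exists>a. T = module_action \<iota> a"
proof -
  have T_tensor: "blinfun_apply T (\<iota> (pscale a (const_bcontfun x))) =
      blinfun_apply (module_action \<iota> a) (blinfun_apply T (\<iota> (const_bcontfun x)))" for a x
    using comm[OF const_in_cyclic_subspace] by (simp add: module_action_\<iota>)
  have "\<exists>a. blinfun_apply T (\<iota> (const_bcontfun x)) = \<iota> (pscale a (const_bcontfun x))" for x
  proof (rule dominated_in_cyclic_subspace)
    show "blinfun_apply T (\<iota> (const_bcontfun x)) \<in> cyclic_subspace \<iota> x"
      using inv const_in_cyclic_subspace by blast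
    show "norm (blinfun_apply (module_action \<iota> a) (blinfun_apply T (\<iota> (const_bcontfun x)))) \<le>
        norm T * norm (\<iota> (pscale a (const_bcontfun x)))" for a
      by (simp only: T_tensor[symmetric] norm_blinfun)
  qed
  then obtain \<alpha> where \<alpha>:
    "\<And>x. blinfun_apply T (\<iota> (const_bcontfun x)) = \<iota> (pscale (\<alpha> x) (const_bcontfun x))"
    by metis
  define A where "A x = pscale (\<alpha> x) (const_bcontfun x)" for x
  have \<iota>_A: "\<iota> (A x) = blinfun_apply T (\<iota> (const_bcontfun x))" for x
    by (simp add: A_def \<alpha>)
  have A_add: "A (x + y) = A x + A y" and A_scale: "A (r *\<^sub>R x) = r *\<^sub>R A x" for x y r
    unfolding inj_\<iota>[symmetric]
    by (simp_all add: \<iota>_A linear_add[OF linear_\<iota>] linear_scale[OF linear_\<iota>]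
        linear_add[OF linear_const_bcontfun] linear_scale[OF linear_const_bcontfun]
        blinfun.add_right blinfun.scaleR_right)
  have "\<exists>c. \<forall>x. apply_bcontfun (A x) t = c *\<^sub>R x" for t
  proof (rule linear_eigenvectors_imp_scalar)
    show "linear (\<lambda>x. apply_bcontfun (A x) t)" by (rule linearI) (simp_all add: A_add A_scale)
  qed (auto simp: A_def)
  then obtain c where c: "\<And>t x. apply_bcontfun (\<alpha> x) t *\<^sub>R x = c t *\<^sub>R x"
    by (simp add: A_def) metis
  \<comment> \<open>The pointwise eigenvalue \<open>c\<close> is continuous because it is \<open>\<alpha> x0\<close> for any nonzero \<open>x0\<close>.\<close>
  obtain a where a: "\<And>x. pscale (\<alpha> x) (const_bcontfun x) = pscale a (const_bcontfun x)"
  proof (cases "\<exists>x0::'x. x0 \<noteq> 0")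
    case True
    then obtain x0 :: 'x where "x0 \<noteq> 0" by blast
    with c have "apply_bcontfun (\<alpha> x0) t = c t" for t by (metis scaleR_cancel_right)
    with c show thesis by (intro that[of "\<alpha> x0"] bcontfun_eqI) simp
  next
    case False
    then have "(x::'x) = y" for x y by metis
    then show thesis by (intro that[of 0] bcontfun_eqI)
  qed
  have "T = module_action \<iota> a"
    by (rule blinfun_eq_on_closure_span[OF _ closure_span_tensors])
      (auto simp: T_tensor \<alpha> a module_action_\<iota> pscale_commute[of a])
  then show ?thesis by blast
qed

end

theorem theorem3:
  fixes J :: "('k::t2_space \<Rightarrow>\<^sub>C real) \<Rightarrow> ('f::banach_lattice \<Rightarrow>\<^sub>L 'f)"
    and u :: 'f
    and \<iota> :: "('k \<Rightarrow>\<^sub>C 'x::banach) \<Rightarrow> 'e::banach"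
    and T :: "'e \<Rightarrow>\<^sub>L 'e"
  assumes "compact (UNIV :: 'k set)"
    and "center_identification J"
    and "quasi_interior u" and "norm u = 1"
    and "is_completion (F_norm J u) \<iota>"
  shows "(\<exists>a. \<forall>f. blinfun_apply T f = blinfun_apply (module_action \<iota> a) f) \<longleftrightarrow>
    (\<forall>x. blinfun_apply T ` cyclic_subspace \<iota> x \<subseteq> cyclic_subspace \<iota> x) \<and>
    (\<forall>x. \<forall>a. \<forall>g \<in> cyclic_subspace \<iota> x.
       blinfun_apply T (blinfun_apply (module_action \<iota> a) g) =
       blinfun_apply (module_action \<iota> a) (blinfun_apply T g))"
proof -
  interpret vector_valued_lattice J u \<iota>
    using assms by unfold_locales
  show ?thesis
  proof
    assume "\<exists>a. \<forall>f. blinfun_apply T f = blinfun_apply (module_action \<iota> a) f"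
    then obtain a where "T = module_action \<iota> a" by (metis blinfun_eqI)
    then show "(\<forall>x. blinfun_apply T ` cyclic_subspace \<iota> x \<subseteq> cyclic_subspace \<iota> x) \<and>
      (\<forall>x. \<forall>a. \<forall>g \<in> cyclic_subspace \<iota> x.
         blinfun_apply T (blinfun_apply (module_action \<iota> a) g) =
         blinfun_apply (module_action \<iota> a) (blinfun_apply T g))"
      using module_action_cyclic_subspace module_action_commute by blast
  next
    assume "(\<forall>x. blinfun_apply T ` cyclic_subspace \<iota> x \<subseteq> cyclic_subspace \<iota> x) \<and>
      (\<forall>x. \<forall>a. \<forall>g \<in> cyclic_subspace \<iota> x.
         blinfun_apply T (blinfun_apply (module_action \<iota> a) g) =
         blinfun_apply (module_action \<iota> a) (blinfun_apply T g))"
    then have "\<exists>a. T = module_action \<iota> a" by (intro multiplication_operatorI) blast+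
    then show "\<exists>a. \<forall>f. blinfun_apply T f = blinfun_apply (module_action \<iota> a) f" by blast
  qed
qed

end
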